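(* Let $n\geq1$, $\mathcal{Q}=2n+2$, and let $u_0,u_1\in L^1(\mathbf{H}_n)$ satisfy \[ \liminf_{R\to\infty}\int_{\mathcal{D}_R}\big(u_0(\eta)+u_1(\eta)\big)\,d\eta>0, \] where $\mathcal{D}_R=B_n(R)\times B_n(R)\times[-R^2,R^2]$. Assume that $u\in L^p_{\mathrm{loc}}([0,T)\times\mathbf{H}_n)$ is a weak solution on $[0,T)\times\mathbf{H}_n$ of \[ u_{tt}-\Delta_H u+u_t=|u|^p,\qquad u(0,\cdot)=u_0,\quad u_t(0,\cdot)=u_1, \] with life-span $T>0$. If $1<p\leq 1+\frac{2}{\mathcal{Q}}$, then $T<\infty$, i.e. the solution blows up in finite time.
   Context: $\mathbf{H}_n$ is the Heisenberg group $\mathbb{R}^{2n+1}$ with points $\eta=(x,y,\tau)$ and product $(x,y,\tau)\circ(x',y',\tau')=(x+x',y+y',\tau+\tau'+\frac12(x\cdot y'-x'\cdot y))$; Lebesgue measure is the Haar measure. $B_n(R)$ is the Euclidean ball of radius $R$ centered at $0$ in $\mathbb{R}^n$. $X_j=\partial_{x_j}-\frac{y_j}{2}\partial_\tau$, $Y_j=\partial_{y_j}+\frac{x_j}{2}\partial_\tau$, $\Delta_H=\sum_{j=1}^n(X_j^2+Y_j^2)$. A weak solution on $[0,T)\times\mathbf{H}_n$ is a function $u\in L^p_{\mathrm{loc}}([0,T)\times\mathbf{H}_n)$ such that for every $\varphi\in\mathcal{C}_0^\infty([0,T)\times\mathbf{H}_n)$, \[ \int_0^T\!\!\int_{\mathbf{H}_n}|u|^p\varphi\,d\eta\,dt+\int_{\mathbf{H}_n}(u_0+u_1)\varphi(0,\eta)\,d\eta-\int_{\mathbf{H}_n}u_0\,\partial_t\varphi(0,\eta)\,d\eta=\int_0^T\!\!\int_{\mathbf{H}_n}u\big(\partial_t^2\varphi-\Delta_H\varphi-\partial_t\varphi\big)\,d\eta\,dt.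 \] The life-span is the supremum of $T$ for which such a solution exists; $T=\infty$ means a global weak solution. *)

theory Defs
  imports "HOL-Analysis.Analysis"
begin

text \<open>Points of the Heisenberg group H_n = R^(2n+1), written (x,y,tau); n = CARD('n).
  Space-time points are pairs (t, eta).\<close>
type_synonym 'n heis = "(real^'n) \<times> (real^'n) \<times> real"

definition dirD :: "('a::real_normed_vector \<Rightarrow> real) \<Rightarrow> 'a \<Rightarrow> 'a \<Rightarrow> real" where
  "dirD f v z = frechet_derivative f (at z) v"

fun iterD :: "'a::real_normed_vector list \<Rightarrow> ('a \<Rightarrow> real) \<Rightarrow> 'a \<Rightarrow> real" where
  "iterD [] f = f"
| "iterD (v # vs) f = (\<lambda>z. dirD (iterD vs f) v z)"

definition smooth_fun :: "('a::real_normed_vector \<Rightarrow> real) \<Rightarrow> bool" where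
  "smooth_fun f \<longleftrightarrow> (\<forall>vs z. iterD vs f differentiable (at z))"

definition dt :: "(real \<times> 'n::finite heis \<Rightarrow> real) \<Rightarrow> real \<times> 'n heis \<Rightarrow> real" where
  "dt f z = dirD f (1, 0) z"

text \<open>Left-invariant vector fields X_j = d/dx_j - y_j/2 d/dtau, Y_j = d/dy_j + x_j/2 d/dtau.\<close>
definition Xf :: "'n::finite \<Rightarrow> (real \<times> 'n heis \<Rightarrow> real) \<Rightarrow> real \<times> 'n heis \<Rightarrow> real" where
  "Xf j f z = (case z of (t, x, y, \<tau>) \<Rightarrow> dirD f (0, (axis j 1, 0, - (y $ j) / 2)) z)"

definition Yf :: "'n::finite \<Rightarrow> (real \<times> 'n heis \<Rightarrow> real) \<Rightarrow> real \<times> 'n heis \<Rightarrow> real" where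
  "Yf j f z = (case z of (t, x, y, \<tau>) \<Rightarrow> dirD f (0, (0, axis j 1, (x $ j) / 2)) z)"

definition subLap :: "(real \<times> 'n::finite heis \<Rightarrow> real) \<Rightarrow> real \<times> 'n heis \<Rightarrow> real" where
  "subLap f z = (\<Sum>j\<in>UNIV. Xf j (Xf j f) z + Yf j (Yf j f) z)"

definition strip :: "ereal \<Rightarrow> (real \<times> 'n::finite heis) set" where
  "strip T = {z. 0 \<le> fst z \<and> ereal (fst z) < T}"

text \<open>Test functions C_0^infinity([0,T) x H_n): smooth functions on R x H_n whose support is
  compact and contained in {t < T}.\<close>
definition test_fun :: "ereal \<Rightarrow> (real \<times> 'n::finite heis \<Rightarrow> real) \<Rightarrow> bool" where
  "test_fun T \<phi> \<longleftrightarrow> smooth_fun \<phi> \<and> compact (closure {z. \<phi> z \<noteq> 0})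
     \<and> (\<forall>z\<in>closure {z. \<phi> z \<noteq> 0}. ereal (fst z) < T)"

definition Lp_loc :: "real \<Rightarrow> ereal \<Rightarrow> (real \<times> 'n::finite heis \<Rightarrow> real) \<Rightarrow> bool" where
  "Lp_loc p T u \<longleftrightarrow> u \<in> borel_measurable lborel \<and>
     (\<forall>K. compact K \<and> K \<subseteq> strip T \<longrightarrow> set_integrable lborel K (\<lambda>z. \<bar>u z\<bar> powr p))"

text \<open>Weak solution of u_tt - Delta_H u + u_t = |u|^p, u(0)=u0, u_t(0)=u1 on [0,T) x H_n.\<close>
definition weak_solution :: "real \<Rightarrow> ('n::finite heis \<Rightarrow> real) \<Rightarrow> ('n heis \<Rightarrow> real)
    \<Rightarrow> ereal \<Rightarrow> (real \<times> 'n heis \<Rightarrow> real) \<Rightarrow> bool" where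
  "weak_solution p u0 u1 T u \<longleftrightarrow> Lp_loc p T u \<and>
     (\<forall>\<phi>. test_fun T \<phi> \<longrightarrow>
        (\<integral>z\<in>strip T. \<bar>u z\<bar> powr p * \<phi> z \<partial>lborel)
        + (\<integral>\<eta>. (u0 \<eta> + u1 \<eta>) * \<phi> (0, \<eta>) \<partial>lborel)
        - (\<integral>\<eta>. u0 \<eta> * dt \<phi> (0, \<eta>) \<partial>lborel)
        = (\<integral>z\<in>strip T. u z * (dt (dt \<phi>) z - subLap \<phi> z - dt \<phi> z) \<partial>lborel))"

definition lifespan :: "real \<Rightarrow> ('n::finite heis \<Rightarrow> real) \<Rightarrow> ('n heis \<Rightarrow> real) \<Rightarrow> ereal" where
  "lifespan p u0 u1 = Sup {T. T > 0 \<and> (\<exists>u. weak_solution p u0 u1 T u)}"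

definition DR :: "real \<Rightarrow> 'n::finite heis set" where
  "DR R = {(x, y, \<tau>). norm x < R \<and> norm y < R \<and> \<bar>\<tau>\<bar> \<le> R^2}"

end

theory Submission
  imports Defs "HOL-Real_Asymp.Real_Asymp"
begin

text \<open>
  Suppose u is a global weak solution. Test it against the dilates
  phi_R = f(1 - N / R^4) of one bump, where N = t^2 + (|x|^2 + |y|^2)^2 + tau^2 is homogeneous of
  degree 4 for the parabolic dilations and f(s) = exp(-1/s) for s > 0. Writing L for the adjoint
  linear operator, psi_R = R^2 L phi_R satisfies |psi_R| \<le> C phi_R^(1/p) uniformly in R \<ge> 1, and
  psi_R \<rightarrow> 0 pointwise. The support of phi_R lies in a box of volume comparable to R^(Q+2), and
  p \<le> 1 + 2/Q says exactly that R^(-2q) R^(Q+2) \<le> 1 for the conjugate exponent q. Young's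
  inequality with a parameter eps therefore bounds the right-hand side of the weak formulation by
  eps^(-p) \<integral> |u|^p |psi_R|^p + C' eps^q. A first choice of eps shows that |u|^p is integrable; then
  dominated convergence sends the first term to 0 for every eps, and letting eps \<rightarrow> 0 contradicts
  \<integral> (u0 + u1) > 0. As N is even in t, the time derivative of phi_R vanishes at t = 0, so the term
  with u0 alone drops out.
\<close>

subsection \<open>A flat function and its smooth compositions with polynomials\<close>

text \<open>\<open>flat 0\<close> is the classical smooth flat function exp(-1/x) extended by 0. The
  extra powers of 1/x are carried along because differentiation maps the span of this family into
  itself.\<close>

definition flat :: "nat \<Rightarrow> real \<Rightarrow> real" where
  "flat m x = (if 0 < x then (1 / x) ^ m * exp (- (1 / x)) else 0)"

lemma power_le_fact_exp:
  fixes y :: real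
  assumes "0 \<le> y"
  shows "y ^ k \<le> fact k * exp y"
proof -
  have "(\<lambda>n. inverse (fact n) * y ^ n) k \<le> (\<Sum>n. inverse (fact n) * y ^ n)"
    using sum_le_suminf[OF summable_exp, of "{k}" y] assms by auto
  also have "\<dots> = exp y"
    by (simp add: exp_def divide_inverse mult.commute scaleR_conv_of_real)
  finally show ?thesis
    by (simp add: field_simps)
qed

lemma flat_nonneg [simp]: "0 \<le> flat m x"
  by (simp add: flat_def)

text \<open>The exponential series at 1/x bounds (1/x)^(m+k) by a multiple of exp(1/x). The case k =
  2 gives the derivative at 0, and k = 0 gives the bound by a constant.\<close>

lemma flat_le:
  assumes "0 < x"
  shows "flat m x \<le> fact (m + k) * x ^ k"
proof -
  have "(1 / x) ^ (m + k) \<le> fact (m + k) * exp (1 / x)"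
    using assms by (intro power_le_fact_exp) simp
  then have "(1 / x) ^ (m + k) * exp (- (1 / x)) \<le> fact (m + k) * exp (1 / x) * exp (- (1 / x))"
    by (intro mult_right_mono) auto
  also have "\<dots> = fact (m + k)"
    by (simp add: exp_minus)
  finally show ?thesis
    using assms by (simp add: flat_def power_add power_divide field_simps)
qed

lemma flat_le_const: "flat m x \<le> fact m"
  using flat_le[of x m 0] by (cases "0 < x") (auto simp: flat_def)

text \<open>Splitting exp(-1/x) as exp(-a/x) exp(-1/(p x)) with a = 1 - 1/p, the first factor
  absorbs (1/x)^m and the second is \<open>flat 0 x powr (1 / p)\<close>. This is how derivatives of
  the bump are controlled by a power of the bump itself.\<close>

lemma flat_le_flat0_powr:
  assumes "1 < p"
  shows "flat m x \<le> fact m / (1 - 1 / p) ^ m * flat 0 x powr (1 / p)"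
proof (cases "0 < x")
  case True
  define a where "a = 1 - 1 / p"
  have a: "0 < a" using assms by (simp add: a_def)
  have "(a * (1 / x)) ^ m \<le> fact m * exp (a * (1 / x))"
    using True a by (intro power_le_fact_exp) simp
  then have "(1 / x) ^ m \<le> fact m / a ^ m * exp (a / x)"
    using a by (simp add: power_mult_distrib field_simps)
  then have "flat m x \<le> fact m / a ^ m * exp (a / x) * exp (- (1 / x))"
    unfolding flat_def using True by (auto intro: mult_right_mono simp del: times_divide_eq_left)
  also have "exp (a / x) * exp (- (1 / x)) = exp (- (1 / x) * (1 / p))"
    unfolding exp_add[symmetric] using True assms by (simp add: a_def divide_simps)
  then have "fact m / a ^ m * exp (a / x) * exp (- (1 / x)) = fact m / a ^ m * flat 0 x powr (1 / p)"
    using True by (simp add: flat_def powr_def mult.assoc)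
  finally show ?thesis by (simp add: a_def)
qed (simp add: flat_def)

lemma flat_has_derivative_at_0: "(flat m has_real_derivative 0) (at 0)"
proof -
  have "\<bar>flat m h / h\<bar> \<le> fact (m + 2) * \<bar>h\<bar>" for h
  proof (cases "0 < h")
    case True
    then show ?thesis
      using flat_le[of h m 2] by (simp add: power2_eq_square divide_le_eq abs_mult mult.assoc)
  next
    case False
    have "0 \<le> fact (m + 2) * \<bar>h\<bar>" by (intro mult_nonneg_nonneg fact_ge_zero abs_ge_zero)
    with False show ?thesis by (simp only: flat_def if_False div_0 abs_zero)
  qed
  then have "\<forall>\<^sub>F h in at 0. norm (flat m h / h) \<le> fact (m + 2) * \<bar>h\<bar>"
    by simp
  moreover have "((\<lambda>h. fact (m + 2) * \<bar>h\<bar>) \<longlongrightarrow> (0::real)) (at 0)"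
    by (auto intro!: tendsto_eq_intros)
  ultimately have "((\<lambda>h. flat m h / h) \<longlongrightarrow> 0) (at 0)"
    by (rule Lim_null_comparison)
  then show ?thesis
    by (simp add: DERIV_def flat_def)
qed

lemma flat_deriv:
  "(flat m has_real_derivative flat (m + 2) x - of_nat m * flat (m + 1) x) (at x)"
proof -
  consider "0 < x" | "x < 0" | "x = 0" by linarith
  then show ?thesis
  proof cases
    case 1
    let ?y = "1 / x"
    have "((\<lambda>y. y ^ m * exp (- y)) has_real_derivative
        of_nat m * ?y ^ (m - 1) * exp (- ?y) - ?y ^ m * exp (- ?y)) (at ?y)"
      by (auto intro!: derivative_eq_intros)
    moreover have "((\<lambda>x. 1 / x) has_real_derivative - (?y\<^sup>2)) (at x)"
      using 1 by (auto intro!: derivative_eq_intros simp: power2_eq_square)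
    ultimately have "((\<lambda>x. (1 / x) ^ m * exp (- (1 / x))) has_real_derivative
        (of_nat m * ?y ^ (m - 1) * exp (- ?y) - ?y ^ m * exp (- ?y)) * - (?y\<^sup>2)) (at x)"
      by (rule DERIV_chain2)
    \<comment> \<open>The subtraction m - 1 is truncated at m = 0, where the factor
      \<open>of_nat m\<close> removes the term; hence the case split on m.\<close>
    moreover have "(of_nat m * y ^ (m - 1) * e - y ^ m * e) * - (y\<^sup>2)
        = y ^ (m + 2) * e - of_nat m * (y ^ (m + 1) * e)" for y e :: real
      by (cases m) (simp_all add: power2_eq_square algebra_simps)
    ultimately have "((\<lambda>x. (1 / x) ^ m * exp (- (1 / x))) has_real_derivative
        flat (m + 2) x - of_nat m * flat (m + 1) x) (at x)"
      using 1 by (simp only: flat_def if_True)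
    then show ?thesis
      by (rule has_field_derivative_transform_within_open[where S = "{0<..}"])
        (use 1 in \<open>auto simp: flat_def\<close>)
  next
    case 2
    have "((\<lambda>x. 0) has_real_derivative flat (m + 2) x - of_nat m * flat (m + 1) x) (at x)"
      using 2 by (simp add: flat_def)
    then show ?thesis
      by (rule has_field_derivative_transform_within_open[where S = "{..<0}"])
        (use 2 in \<open>auto simp: flat_def\<close>)
  next
    case 3
    then show ?thesis
      using flat_has_derivative_at_0[of m] by (simp add: flat_def)
  qed
qed

lemma continuous_on_flat: "continuous_on UNIV (flat m)"
  using flat_deriv by (blast intro: continuous_at_imp_continuous_on DERIV_isCont)

section \<open>Smoothness of \<open>flat\<close> composed with a polynomial\<close>

lemma flat_comp_has_derivative:
  assumes "(P has_derivative P') (at z)"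
  shows "((\<lambda>z. flat m (P z)) has_derivative
    (\<lambda>v. (flat (m + 2) (P z) - of_nat m * flat (m + 1) (P z)) * P' v)) (at z)"
  using has_derivative_compose[OF assms flat_deriv[unfolded has_field_derivative_def]] by simp

lemma dirD_eq: "(f has_derivative f') (at z) \<Longrightarrow> dirD f v z = f' v"
  unfolding dirD_def using frechet_derivative_at[of f f' z] by simp

text \<open>The derivative is polynomial in the base point for each fixed direction v, which is the
  form that iterating \<open>dirD\<close> requires.\<close>

lemma real_polynomial_function_has_derivative:
  assumes "real_polynomial_function Q"
  shows "\<exists>Q'. (\<forall>z. (Q has_derivative Q' z) (at z)) \<and> (\<forall>v. real_polynomial_function (\<lambda>z. Q' z v))"
  using assms
proof induction
  case (linear f)
  then show ?case by (intro exI[of _ "\<lambda>z. f"]) (auto intro: bounded_linear_imp_has_derivative)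
next
  case (const c)
  then show ?case by (intro exI[of _ "\<lambda>z v. 0"]) auto
next
  case (add f g)
  then obtain f' g' where "\<forall>z. (f has_derivative f' z) (at z)" "\<forall>v. real_polynomial_function (\<lambda>z. f' z v)"
    "\<forall>z. (g has_derivative g' z) (at z)" "\<forall>v. real_polynomial_function (\<lambda>z. g' z v)" by blast
  then show ?case
    by (intro exI[of _ "\<lambda>z v. f' z v + g' z v"]) (auto intro!: derivative_intros)
next
  case (mult f g)
  then obtain f' g' where "\<forall>z. (f has_derivative f' z) (at z)" "\<forall>v. real_polynomial_function (\<lambda>z. f' z v)"
    "\<forall>z. (g has_derivative g' z) (at z)" "\<forall>v. real_polynomial_function (\<lambda>z. g' z v)" by blast
  with mult.hyps show ?case
    by (intro exI[of _ "\<lambda>z v. f z * g' z v + f' z v * g z"]) (auto intro!: has_derivative_mult real_polynomial_function.intros(3) real_polynomial_function.intros(4))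
qed

text \<open>This span contains the test functions and is closed under directional derivatives, which gives
  smoothness in the sense of \<^const>\<open>smooth_fun\<close>.\<close>

inductive flat_span :: "('a::real_normed_vector \<Rightarrow> real) \<Rightarrow> ('a \<Rightarrow> real) \<Rightarrow> bool" for P where
  base: "real_polynomial_function Q \<Longrightarrow> flat_span P (\<lambda>z. Q z * flat m (P z))"
| add: "flat_span P f \<Longrightarrow> flat_span P g \<Longrightarrow> flat_span P (\<lambda>z. f z + g z)"

text \<open>By the product rule a generator with index m splits into three generators, with indices
  m + 2, m + 1 and m.\<close>

lemma flat_span_has_derivative:
  assumes P: "real_polynomial_function P" and "flat_span P f"
  shows "\<exists>f'. (\<forall>z. (f has_derivative f' z) (at z)) \<and> (\<forall>v. flat_span P (\<lambda>z. f' z v))"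
  using assms(2)
proof induction
  case (base Q m)
  obtain Q' where Q': "\<And>z. (Q has_derivative Q' z) (at z)" "\<And>v. real_polynomial_function (\<lambda>z. Q' z v)"
    using real_polynomial_function_has_derivative[OF base] by blast
  obtain P' where P': "\<And>z. (P has_derivative P' z) (at z)" "\<And>v. real_polynomial_function (\<lambda>z. P' z v)"
    using real_polynomial_function_has_derivative[OF P] by blast
  have "((\<lambda>z. Q z * flat m (P z)) has_derivative
      (\<lambda>v. Q z * P' z v * flat (m + 2) (P z) + (- of_nat m * (Q z * P' z v)) * flat (m + 1) (P z)
        + Q' z v * flat m (P z))) (at z)" for z
    by (rule has_derivative_eq_rhs[OF has_derivative_mult[OF Q'(1) flat_comp_has_derivative[OF P'(1)]]])
      (simp add: algebra_simps)
  moreover have "flat_span P (\<lambda>z. Q z * P' z v * flat (m + 2) (P z)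
      + (- of_nat m * (Q z * P' z v)) * flat (m + 1) (P z) + Q' z v * flat m (P z))" for v
    using base Q'(2) P'(2)
    by (intro flat_span.intros real_polynomial_function.intros(4) real_polynomial_function.intros(2)) auto
  ultimately show ?case
    by (intro exI[of _ "\<lambda>z v. Q z * P' z v * flat (m + 2) (P z)
      + (- of_nat m * (Q z * P' z v)) * flat (m + 1) (P z) + Q' z v * flat m (P z)"]) blast
next
  case (add f g)
  then obtain f' g' where "\<forall>z. (f has_derivative f' z) (at z)" "\<forall>v. flat_span P (\<lambda>z. f' z v)"
    "\<forall>z. (g has_derivative g' z) (at z)" "\<forall>v. flat_span P (\<lambda>z. g' z v)" by blast
  then show ?case
    by (intro exI[of _ "\<lambda>z v. f' z v + g' z v"]) (auto intro!: derivative_intros flat_span.add)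
qed

lemma smooth_fun_flat:
  assumes P: "real_polynomial_function P"
  shows "smooth_fun (\<lambda>z. flat m (P z))"
proof -
  have "flat_span P (iterD vs (\<lambda>z. flat m (P z)))" for vs
  proof (induction vs)
    case Nil
    have "flat_span P (\<lambda>z. 1 * flat m (P z))" by (rule flat_span.base) auto
    then show ?case by simp
  next
    case (Cons v vs)
    then obtain f' where f': "\<And>z. (iterD vs (\<lambda>z. flat m (P z)) has_derivative f' z) (at z)"
        "\<And>v. flat_span P (\<lambda>z. f' z v)"
      using flat_span_has_derivative[OF P] by blast
    show ?case using f' by (simp add: dirD_eq[OF f'(1)])
  qed
  then show ?thesis
    unfolding smooth_fun_def differentiable_def using flat_span_has_derivative[OF P] by blast
qed

subsection \<open>The linear operator on the dilated bump\<close>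

text \<open>A variant of the fourth power of the Koranyi norm, with t given the same weight as tau.
  Being a polynomial, it yields a smooth function when composed with \<open>flat\<close>.\<close>

definition gauge4 :: "real \<times> 'n::finite heis \<Rightarrow> real" where
  "gauge4 = (\<lambda>(t, x, y, \<tau>). t\<^sup>2 + (x \<bullet> x + y \<bullet> y)\<^sup>2 + \<tau>\<^sup>2)"

definition bump :: "real \<Rightarrow> real \<times> 'n::finite heis \<Rightarrow> real" where
  "bump R z = flat 0 (1 - gauge4 z / R ^ 4)"

lemma gauge4_nonneg: "0 \<le> gauge4 z"
  by (auto simp: gauge4_def split: prod.split)

lemma gauge4_has_derivative:
  fixes x y :: "real^'n"
  shows "(gauge4 has_derivative (\<lambda>(t', x', y', \<tau>'). 2 * t * t'
    + 4 * (x \<bullet> x + y \<bullet> y) * (x \<bullet> x' + y \<bullet> y') + 2 * \<tau> * \<tau>')) (at (t, x, y, \<tau>))"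
  unfolding gauge4_def case_prod_beta
  by (auto intro!: derivative_eq_intros simp: algebra_simps inner_commute)

lemma real_polynomial_function_gauge4: "real_polynomial_function (gauge4 :: real \<times> 'n::finite heis \<Rightarrow> real)"
proof -
  have bl: "bounded_linear (\<lambda>z::real \<times> 'n heis. fst (snd z) $ i)"
      "bounded_linear (\<lambda>z::real \<times> 'n heis. fst (snd (snd z)) $ i)"
      "bounded_linear (\<lambda>z::real \<times> 'n heis. snd (snd (snd z)))" for i
    by (auto intro!: bounded_linear_intros bounded_linear_compose[OF bounded_linear_vec_nth])
  show ?thesis
    unfolding gauge4_def case_prod_beta inner_vec_def inner_real_def
    by (intro real_polynomial_function_power real_polynomial_function.intros
        real_polynomial_function_sum bl bounded_linear_fst) auto
qed

section \<open>Explicit first and second derivatives of the bump\<close>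

lemma flat_0_2_comp_has_derivative:
  assumes "(P has_derivative P') (at z)"
  shows "((\<lambda>z. flat 0 (P z)) has_derivative (\<lambda>v. flat 2 (P z) * P' v)) (at z)"
    and "((\<lambda>z. flat 2 (P z)) has_derivative (\<lambda>v. (flat 4 (P z) - 2 * flat 3 (P z)) * P' v)) (at z)"
  using flat_comp_has_derivative[OF assms, of 0] flat_comp_has_derivative[OF assms, of 2]
  by (simp_all add: numeral_eq_Suc)

lemma one_minus_gauge4_has_derivative:
  fixes x y :: "real^'n" and t \<tau> K :: real
  shows "((\<lambda>z. 1 - gauge4 z / K) has_derivative (\<lambda>(t', x', y', \<tau>'). - (2 * t * t'
    + 4 * (x \<bullet> x + y \<bullet> y) * (x \<bullet> x' + y \<bullet> y') + 2 * \<tau> * \<tau>') / K)) (at (t, x, y, \<tau>))"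
proof -
  \<comment> \<open>Division by K becomes multiplication by a constant, so K = 0 needs no separate
    case.\<close>
  define k where "k = inverse K"
  show ?thesis
    unfolding divide_inverse k_def[symmetric]
    by (rule has_derivative_eq_rhs[OF has_derivative_diff[OF has_derivative_const
       has_derivative_mult_left[OF gauge4_has_derivative]]]) (auto simp: algebra_simps)
qed

lemma dt_flat_gauge4:
  fixes x y :: "real^'n" and t \<tau> K :: real
  shows "dt (\<lambda>z. flat 0 (1 - gauge4 z / K)) (t, x, y, \<tau>) = - (2 * t / K) * flat 2 (1 - gauge4 (t, x, y, \<tau>) / K)"
  unfolding dt_def dirD_eq[OF flat_0_2_comp_has_derivative(1)[OF one_minus_gauge4_has_derivative]]
  by (simp add: zero_prod_def)

lemma Xf_flat_gauge4:
  fixes x y :: "real^'n" and t \<tau> K :: real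
  shows "Xf j (\<lambda>z. flat 0 (1 - gauge4 z / K)) (t, x, y, \<tau>)
    = - ((4 * (x \<bullet> x + y \<bullet> y) * x $ j - y $ j * \<tau>) / K) * flat 2 (1 - gauge4 (t, x, y, \<tau>) / K)"
proof -
  have "Xf j (\<lambda>z. flat 0 (1 - gauge4 z / K)) (t, x, y, \<tau>)
      = flat 2 (1 - gauge4 (t, x, y, \<tau>) / K) * ((y $ j * \<tau> - 4 * (x \<bullet> x + y \<bullet> y) * x $ j) / K)"
    unfolding Xf_def prod.case dirD_eq[OF flat_0_2_comp_has_derivative(1)[OF one_minus_gauge4_has_derivative]]
    by (simp add: inner_axis mult.commute[of \<tau>] del: distrib_left_numeral distrib_right_numeral)
  then show ?thesis
    by (simp only: minus_divide_left minus_diff_eq mult.commute)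
qed

lemma Yf_flat_gauge4:
  fixes x y :: "real^'n" and t \<tau> K :: real
  shows "Yf j (\<lambda>z. flat 0 (1 - gauge4 z / K)) (t, x, y, \<tau>)
    = - ((4 * (x \<bullet> x + y \<bullet> y) * y $ j + x $ j * \<tau>) / K) * flat 2 (1 - gauge4 (t, x, y, \<tau>) / K)"
proof -
  have "Yf j (\<lambda>z. flat 0 (1 - gauge4 z / K)) (t, x, y, \<tau>)
      = flat 2 (1 - gauge4 (t, x, y, \<tau>) / K) * ((- (4 * (x \<bullet> x + y \<bullet> y) * y $ j) - x $ j * \<tau>) / K)"
    unfolding Yf_def prod.case dirD_eq[OF flat_0_2_comp_has_derivative(1)[OF one_minus_gauge4_has_derivative]]
    by (simp add: inner_axis mult.commute[of \<tau>] del: distrib_left_numeral distrib_right_numeral)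
  then show ?thesis
    by (simp only: minus_divide_left minus_diff_eq minus_add_distrib diff_conv_add_uminus mult.commute)
qed

lemma dt_dt_flat_gauge4:
  fixes x y :: "real^'n" and t \<tau> K :: real
  defines "w \<equiv> \<lambda>m. flat m (1 - gauge4 (t, x, y, \<tau>) / K)"
  shows "dt (dt (\<lambda>z. flat 0 (1 - gauge4 z / K))) (t, x, y, \<tau>)
    = (2 * t / K)\<^sup>2 * (w 4 - 2 * w 3) - 2 / K * w 2"
proof -
  define k where "k = - inverse K"
  let ?c = "\<lambda>z::real \<times> 'n heis. 2 * fst z * k"
  have eq: "dt (\<lambda>z. flat 0 (1 - gauge4 z / K)) = (\<lambda>z::real \<times> 'n heis. ?c z * flat 2 (1 - gauge4 z / K))"
    using dt_flat_gauge4[of K] by (auto simp: fun_eq_iff k_def divide_inverse)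
  have "(?c has_derivative (\<lambda>v. 2 * fst v * k)) (at z)" for z
    by (auto intro!: derivative_eq_intros)
  note D = dirD_eq[OF has_derivative_mult[OF this flat_0_2_comp_has_derivative(2)[OF
    one_minus_gauge4_has_derivative[where t = t and x = x and y = y and \<tau> = \<tau> and K = K]]]]
  show ?thesis
    unfolding eq dt_def D by (simp add: w_def k_def divide_inverse zero_prod_def algebra_simps power2_eq_square)
qed

text \<open>With r = |x|^2 + |y|^2, X_j sends the gauge to 4 r x_j - y_j tau, and sends that to 8
  x_j^2 + 4 r + y_j^2 / 2. The two terms are the chain rule for \<open>flat 0\<close>, whose second
  derivative is \<open>flat 4\<close> minus twice \<open>flat 3\<close>.\<close>

lemma Xf_Xf_flat_gauge4:
  fixes x y :: "real^'n" and t \<tau> K :: real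
  defines "w \<equiv> \<lambda>m. flat m (1 - gauge4 (t, x, y, \<tau>) / K)"
  shows "Xf j (Xf j (\<lambda>z. flat 0 (1 - gauge4 z / K))) (t, x, y, \<tau>)
    = ((4 * (x \<bullet> x + y \<bullet> y) * x $ j - y $ j * \<tau>) / K)\<^sup>2 * (w 4 - 2 * w 3)
      - (8 * (x $ j)\<^sup>2 + 4 * (x \<bullet> x + y \<bullet> y) + (y $ j)\<^sup>2 / 2) / K * w 2"
proof -
  let ?r = "\<lambda>z::real \<times> 'n heis. fst (snd z) \<bullet> fst (snd z) + fst (snd (snd z)) \<bullet> fst (snd (snd z))"
  define k where "k = - inverse K"
  let ?c = "\<lambda>z::real \<times> 'n heis. (4 * ?r z * (fst (snd z) \<bullet> axis j 1)
     - (fst (snd (snd z)) \<bullet> axis j 1) * snd (snd (snd z))) * k"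
  have eq: "Xf j (\<lambda>z. flat 0 (1 - gauge4 z / K)) = (\<lambda>z. ?c z * flat 2 (1 - gauge4 z / K))"
    by (auto simp: fun_eq_iff Xf_flat_gauge4 inner_axis k_def) (simp_all add: divide_inverse)
  have "(?c has_derivative (\<lambda>v. (
      8 * (fst (snd z) \<bullet> fst (snd v) + fst (snd (snd z)) \<bullet> fst (snd (snd v))) * (fst (snd z) \<bullet> axis j 1)
      + 4 * ?r z * (fst (snd v) \<bullet> axis j 1)
      - (fst (snd (snd v)) \<bullet> axis j 1) * snd (snd (snd z))
      - (fst (snd (snd z)) \<bullet> axis j 1) * snd (snd (snd v))) * k)) (at z)" for z
    by (auto intro!: derivative_eq_intros simp: inner_commute algebra_simps)
  note D = dirD_eq[OF has_derivative_mult[OF this flat_0_2_comp_has_derivative(2)[OF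
    one_minus_gauge4_has_derivative[where t = t and x = x and y = y and \<tau> = \<tau> and K = K]]]]
  \<comment> \<open>The minus sign in k and the one from differentiating 1 - gauge/K cancel in the
    first term; only the one in k survives in the second.\<close>
  have "c * k * (W * (- c) / K) + d * k * w2 = (c / K)\<^sup>2 * W - d / K * w2" for c W d w2
    by (simp add: k_def power2_eq_square divide_inverse)
  from this[of "4 * (x \<bullet> x + y \<bullet> y) * x $ j - y $ j * \<tau>" "w 4 - 2 * w 3"
      "8 * (x $ j)\<^sup>2 + 4 * (x \<bullet> x + y \<bullet> y) + (y $ j)\<^sup>2 / 2" "w 2"]
  show ?thesis
    unfolding eq Xf_def prod.case D
    by (simp add: w_def inner_axis power2_eq_square mult.assoc add.commute mult.commute[of \<tau> "y $ j"]
        del: distrib_left_numeral distrib_right_numeral mult_eq_0_iff mult_cancel_left mult_cancel_right)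
qed

lemma Yf_Yf_flat_gauge4:
  fixes x y :: "real^'n" and t \<tau> K :: real
  defines "w \<equiv> \<lambda>m. flat m (1 - gauge4 (t, x, y, \<tau>) / K)"
  shows "Yf j (Yf j (\<lambda>z. flat 0 (1 - gauge4 z / K))) (t, x, y, \<tau>)
    = ((4 * (x \<bullet> x + y \<bullet> y) * y $ j + x $ j * \<tau>) / K)\<^sup>2 * (w 4 - 2 * w 3)
      - (8 * (y $ j)\<^sup>2 + 4 * (x \<bullet> x + y \<bullet> y) + (x $ j)\<^sup>2 / 2) / K * w 2"
proof -
  let ?r = "\<lambda>z::real \<times> 'n heis. fst (snd z) \<bullet> fst (snd z) + fst (snd (snd z)) \<bullet> fst (snd (snd z))"
  define k where "k = - inverse K"
  let ?c = "\<lambda>z::real \<times> 'n heis. (4 * ?r z * (fst (snd (snd z)) \<bullet> axis j 1)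
     + (fst (snd z) \<bullet> axis j 1) * snd (snd (snd z))) * k"
  have eq: "Yf j (\<lambda>z. flat 0 (1 - gauge4 z / K)) = (\<lambda>z. ?c z * flat 2 (1 - gauge4 z / K))"
    by (auto simp: fun_eq_iff Yf_flat_gauge4 inner_axis k_def) (simp_all add: divide_inverse)
  have "(?c has_derivative (\<lambda>v. (
      8 * (fst (snd z) \<bullet> fst (snd v) + fst (snd (snd z)) \<bullet> fst (snd (snd v))) * (fst (snd (snd z)) \<bullet> axis j 1)
      + 4 * ?r z * (fst (snd (snd v)) \<bullet> axis j 1)
      + (fst (snd v) \<bullet> axis j 1) * snd (snd (snd z))
      + (fst (snd z) \<bullet> axis j 1) * snd (snd (snd v))) * k)) (at z)" for z
    by (auto intro!: derivative_eq_intros simp: inner_commute algebra_simps)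
  note D = dirD_eq[OF has_derivative_mult[OF this flat_0_2_comp_has_derivative(2)[OF
    one_minus_gauge4_has_derivative[where t = t and x = x and y = y and \<tau> = \<tau> and K = K]]]]
  have "c * k * (W * (- c) / K) + d * k * w2 = (c / K)\<^sup>2 * W - d / K * w2" for c W d w2
    by (simp add: k_def power2_eq_square divide_inverse)
  from this[of "4 * (x \<bullet> x + y \<bullet> y) * y $ j + x $ j * \<tau>" "w 4 - 2 * w 3"
      "8 * (y $ j)\<^sup>2 + 4 * (x \<bullet> x + y \<bullet> y) + (x $ j)\<^sup>2 / 2" "w 2"]
  show ?thesis
    unfolding eq Yf_def prod.case D
    by (simp add: w_def inner_axis power2_eq_square mult.assoc add.commute mult.commute[of \<tau> "x $ j"]
        del: distrib_left_numeral distrib_right_numeral mult_eq_0_iff mult_cancel_left mult_cancel_right)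
qed

text \<open>The cross terms of the squared X_j and Y_j derivatives cancel, leaving (x_j^2 +
  y_j^2)(16 r^2 + tau^2), and x_j^2 + y_j^2 sums to r. The n copies of 4 r + 4 r give 8 n, while 8 +
  1/2 gives 17/2.\<close>

lemma subLap_flat_gauge4:
  fixes x y :: "real^'n" and t \<tau> K :: real
  defines "w \<equiv> \<lambda>m. flat m (1 - gauge4 (t, x, y, \<tau>) / K)"
  defines "r \<equiv> x \<bullet> x + y \<bullet> y"
  shows "subLap (\<lambda>z. flat 0 (1 - gauge4 z / K)) (t, x, y, \<tau>)
    = r * (16 * r\<^sup>2 + \<tau>\<^sup>2) / K\<^sup>2 * (w 4 - 2 * w 3) - (8 * CARD('n) + 17 / 2) * r / K * w 2"
proof -
  have collect: "r * (X / K\<^sup>2 * W - c / K * v) - N * (8 * r / K * v)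
      = r * X / K\<^sup>2 * W - (8 * N + c) * r / K * v" for X W v c N :: real
    by (simp add: divide_inverse algebra_simps)
  have w: "flat m (1 - gauge4 (t, x, y, \<tau>) / K) = w m" for m
    by (simp add: w_def)
  define s where "s = (\<lambda>j. (x $ j)\<^sup>2 + (y $ j)\<^sup>2)"
  have r: "r = (\<Sum>j\<in>UNIV. s j)"
    by (simp add: r_def s_def inner_vec_def power2_eq_square sum.distrib)
  have "subLap (\<lambda>z. flat 0 (1 - gauge4 z / K)) (t, x, y, \<tau>)
      = (\<Sum>j\<in>UNIV. s j * ((16 * r\<^sup>2 + \<tau>\<^sup>2) / K\<^sup>2 * (w 4 - 2 * w 3) - 17 / 2 / K * w 2) - 8 * r / K * w 2)"
    unfolding subLap_def Xf_Xf_flat_gauge4 Yf_Yf_flat_gauge4 w r_def[symmetric]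
  proof (intro sum.cong refl)
    fix j
    have "(4 * r * a - b * \<tau>)\<^sup>2 + (4 * r * b + a * \<tau>)\<^sup>2 = (a\<^sup>2 + b\<^sup>2) * (16 * r\<^sup>2 + \<tau>\<^sup>2)" for a b
      by (simp add: power2_eq_square algebra_simps)
    from this[of "x $ j" "y $ j"]
    have sq: "((4 * r * x $ j - y $ j * \<tau>) / K)\<^sup>2 + ((4 * r * y $ j + x $ j * \<tau>) / K)\<^sup>2
        = s j * ((16 * r\<^sup>2 + \<tau>\<^sup>2) / K\<^sup>2)"
      by (simp add: s_def power_divide flip: add_divide_distrib)
    have "(8 * (x $ j)\<^sup>2 + 4 * r + (y $ j)\<^sup>2 / 2) + (8 * (y $ j)\<^sup>2 + 4 * r + (x $ j)\<^sup>2 / 2) = s j * (17 / 2) + 8 * r"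
      by (simp add: s_def)
    then have lin: "(8 * (x $ j)\<^sup>2 + 4 * r + (y $ j)\<^sup>2 / 2) / K + (8 * (y $ j)\<^sup>2 + 4 * r + (x $ j)\<^sup>2 / 2) / K
        = s j * (17 / 2 / K) + 8 * r / K"
      by (simp only: add_divide_distrib[symmetric] times_divide_eq_right)
    have split: "A * W - B * V + (A' * W - B' * V) = (A + A') * W - (B + B') * V" for A A' B B' W V :: real
      by (simp add: algebra_simps)
    show "((4 * r * x $ j - y $ j * \<tau>) / K)\<^sup>2 * (w 4 - 2 * w 3)
        - (8 * (x $ j)\<^sup>2 + 4 * r + (y $ j)\<^sup>2 / 2) / K * w 2
        + (((4 * r * y $ j + x $ j * \<tau>) / K)\<^sup>2 * (w 4 - 2 * w 3)
        - (8 * (y $ j)\<^sup>2 + 4 * r + (x $ j)\<^sup>2 / 2) / K * w 2)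
      = s j * ((16 * r\<^sup>2 + \<tau>\<^sup>2) / K\<^sup>2 * (w 4 - 2 * w 3) - 17 / 2 / K * w 2) - 8 * r / K * w 2"
      unfolding split sq lin
      by (simp only: left_diff_distrib right_diff_distrib distrib_right distrib_left mult.assoc diff_diff_eq add.assoc)
  qed
  also have "\<dots> = r * ((16 * r\<^sup>2 + \<tau>\<^sup>2) / K\<^sup>2 * (w 4 - 2 * w 3) - 17 / 2 / K * w 2)
      - CARD('n) * (8 * r / K * w 2)"
    by (simp add: sum_subtractf sum_distrib_right[symmetric] r)
  also have "\<dots> = r * (16 * r\<^sup>2 + \<tau>\<^sup>2) / K\<^sup>2 * (w 4 - 2 * w 3) - (8 * CARD('n) + 17 / 2) * r / K * w 2"
    by (simp only: collect of_nat_mult of_nat_numeral)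
  finally show ?thesis .
qed

text \<open>The formal adjoint of the damped wave operator: integration by parts flips the sign of
  the first-order time derivative only.\<close>

definition damped_op :: "(real \<times> 'n::finite heis \<Rightarrow> real) \<Rightarrow> real \<times> 'n heis \<Rightarrow> real" where
  "damped_op \<phi> z = dt (dt \<phi>) z - subLap \<phi> z - dt \<phi> z"

lemma bump_eq: "bump R = (\<lambda>z. flat 0 (1 - gauge4 z / R ^ 4))"
  by (simp add: bump_def fun_eq_iff)

lemma damped_op_bump:
  fixes x y :: "real^'n" and t \<tau> :: real
  defines "w \<equiv> \<lambda>R m. flat m (1 - gauge4 (t, x, y, \<tau>) / R ^ 4)"
  defines "r \<equiv> x \<bullet> x + y \<bullet> y"
  shows "damped_op (bump R) (t, x, y, \<tau>)
    = (4 * t\<^sup>2 - r * (16 * r\<^sup>2 + \<tau>\<^sup>2)) / (R ^ 4)\<^sup>2 * (w R 4 - 2 * w R 3)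
      + (2 * t - 2 + (8 * CARD('n) + 17 / 2) * r) / R ^ 4 * w R 2"
proof -
  have w: "flat m (1 - gauge4 (t, x, y, \<tau>) / R ^ 4) = w R m" for m
    by (simp add: w_def)
  have alg: "(2 * t / K)\<^sup>2 * W - 2 / K * v - (r * X / K\<^sup>2 * W - A * r / K * v) - - (2 * t / K) * v
      = (4 * t\<^sup>2 - r * X) / K\<^sup>2 * W + (2 * t - 2 + A * r) / K * v" for K W v X A
    by (simp add: divide_inverse power2_eq_square algebra_simps)
  show ?thesis
    unfolding damped_op_def bump_eq dt_dt_flat_gauge4 subLap_flat_gauge4 dt_flat_gauge4 w r_def[symmetric]
    by (rule alg)
qed

section \<open>Measurability, monotonicity and support of the bump\<close>

lemma continuous_on_gauge4 [continuous_intros]: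
  "continuous_on A f \<Longrightarrow> continuous_on A (\<lambda>z. gauge4 (f z))"
  unfolding gauge4_def case_prod_beta by (intro continuous_intros)

lemma continuous_on_flat_comp [continuous_intros]:
  "continuous_on A f \<Longrightarrow> continuous_on A (\<lambda>z. flat m (f z))"
  by (rule continuous_on_compose2[OF continuous_on_flat]) auto

lemma continuous_on_bump: "continuous_on UNIV (bump R)"
  unfolding bump_eq divide_inverse by (intro continuous_intros)

lemma borel_measurable_bump [measurable]: "bump R \<in> borel_measurable borel"
  by (intro borel_measurable_continuous_onI continuous_on_bump)

text \<open>Measurability is read off the closed formula, which is continuous. The parameters k and
  k' stand for inverse powers of R, so continuity holds for every R.\<close>

lemma borel_measurable_damped_op_bump [measurable]:
  "damped_op (bump R :: real \<times> 'n::finite heis \<Rightarrow> real) \<in> borel_measurable borel"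
proof -
  let ?r = "\<lambda>z::real \<times> 'n heis. fst (snd z) \<bullet> fst (snd z) + fst (snd (snd z)) \<bullet> fst (snd (snd z))"
  let ?f = "\<lambda>A k k' z. (4 * (fst z)\<^sup>2 - ?r z * (16 * (?r z)\<^sup>2 + (snd (snd (snd z)))\<^sup>2)) * k
        * (flat 4 (1 - gauge4 z * k') - 2 * flat 3 (1 - gauge4 z * k'))
      + (2 * fst z - 2 + A * ?r z) * k' * flat 2 (1 - gauge4 z * k')"
  have cont: "continuous_on UNIV (?f A k k')" for A k k'
    by (intro continuous_intros)
  have "damped_op (bump R) = ?f (8 * CARD('n) + 17 / 2) (inverse ((R ^ 4)\<^sup>2)) (inverse (R ^ 4))"
  proof (rule ext)
    fix z :: "real \<times> 'n heis"
    obtain t x y \<tau> where z: "z = (t, x, y, \<tau>)" by (metis surj_pair)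
    show "damped_op (bump R) z = ?f (8 * CARD('n) + 17 / 2) (inverse ((R ^ 4)\<^sup>2)) (inverse (R ^ 4)) z"
      unfolding z by (simp only: damped_op_bump divide_inverse fst_conv snd_conv)
  qed
  then show ?thesis
    by (simp only:) (intro borel_measurable_continuous_onI cont)
qed

lemma bump_nonneg [simp]: "0 \<le> bump R z"
  by (simp add: bump_def)

lemma bump_le_1: "bump R z \<le> 1"
  using flat_le_const[of 0] by (simp add: bump_def)

lemma bump_tendsto:
  "(\<lambda>k. bump (real (Suc k)) z) \<longlonglongrightarrow> exp (- 1)"
proof -
  have "(\<lambda>k. 1 - gauge4 z / (real (Suc k)) ^ 4) \<longlonglongrightarrow> 1 - gauge4 z * 0"
    unfolding divide_inverse
    by (intro tendsto_intros LIMSEQ_Suc) real_asymp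
  then have "(\<lambda>k. flat 0 (1 - gauge4 z / (real (Suc k)) ^ 4)) \<longlonglongrightarrow> flat 0 1"
    by (intro isCont_tendsto_compose[where g="flat 0"] DERIV_isCont[OF flat_deriv]) simp
  then show ?thesis by (simp add: bump_def flat_def)
qed

text \<open>\<open>flat 0\<close> is nondecreasing and its argument grows with R. Together with
  \<open>bump_tendsto\<close> this prepares monotone convergence.\<close>

lemma bump_mono:
  assumes "0 < R" "R \<le> R'"
  shows "bump R z \<le> bump R' z"
proof -
  have "gauge4 z / R' ^ 4 \<le> gauge4 z / R ^ 4"
    using assms gauge4_nonneg[of z] by (intro divide_left_mono power_mono) auto
  then have "flat 0 (1 - gauge4 z / R ^ 4) \<le> flat 0 (1 - gauge4 z / R' ^ 4)"
    by (auto simp: flat_def frac_le)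
  then show ?thesis by (simp add: bump_def)
qed

definition par_box :: "real \<Rightarrow> (real \<times> 'n::finite heis) set" where
  "par_box R = cbox (- (R\<^sup>2, (\<chi> i. R), (\<chi> i. R), R\<^sup>2)) (R\<^sup>2, (\<chi> i. R), (\<chi> i. R), R\<^sup>2)"

text \<open>The exponent 2 n + 4 is Q + 2: the directions t and tau contribute 2 each, and x and y
  contribute n each.\<close>

lemma measure_par_box:
  assumes "0 < R"
  shows "measure lborel (par_box R :: (real \<times> 'n::finite heis) set)
    = 2 ^ (2 * CARD('n) + 2) * R ^ (2 * CARD('n) + 4)"
proof -
  have ne: "cbox (- (\<chi> i. R)) (\<chi> i. R) \<noteq> ({} :: (real^'n) set)"
    using assms by (auto simp: interval_ne_empty_cart)
  have "measure lborel (par_box R :: (real \<times> 'n heis) set)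
      = (2 * R\<^sup>2) * ((2 * R) ^ CARD('n) * ((2 * R) ^ CARD('n) * (2 * R\<^sup>2)))"
    using assms ne by (simp add: par_box_def content_Pair content_cbox_cart uminus_prod_def)
  then show ?thesis
    by (simp add: power_mult_distrib power_add power_mult power2_eq_square power4_eq_xxxx algebra_simps)
qed

lemma gauge4_less_imp_bounds:
  fixes x y :: "real^'n" and t \<tau> :: real
  assumes "0 < R" "gauge4 (t, x, y, \<tau>) < R ^ 4"
  shows "\<bar>t\<bar> \<le> R\<^sup>2" "x \<bullet> x + y \<bullet> y \<le> R\<^sup>2" "\<bar>\<tau>\<bar> \<le> R\<^sup>2"
proof -
  have "t\<^sup>2 + (x \<bullet> x + y \<bullet> y)\<^sup>2 + \<tau>\<^sup>2 \<le> (R\<^sup>2)\<^sup>2"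
    using assms by (simp add: gauge4_def)
  then have "t\<^sup>2 \<le> (R\<^sup>2)\<^sup>2" "(x \<bullet> x + y \<bullet> y)\<^sup>2 \<le> (R\<^sup>2)\<^sup>2" "\<tau>\<^sup>2 \<le> (R\<^sup>2)\<^sup>2"
    by (smt (verit) zero_le_power2)+
  then show "\<bar>t\<bar> \<le> R\<^sup>2" "x \<bullet> x + y \<bullet> y \<le> R\<^sup>2" "\<bar>\<tau>\<bar> \<le> R\<^sup>2"
    using abs_le_square_iff[of _ "R\<^sup>2"] by (force dest: power2_le_imp_le)+
qed

lemma flat_outside:
  assumes "R ^ 4 \<le> gauge4 z" "0 < R"
  shows "flat m (1 - gauge4 z / R ^ 4) = 0"
  using assms by (simp add: flat_def)

lemma gauge4_less_imp_par_box:
  assumes "0 < R" "gauge4 z < R ^ 4"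
  shows "z \<in> par_box R"
proof -
  obtain t x y \<tau> where z: "z = (t, x, y, \<tau>)" by (metis surj_pair)
  note b = gauge4_less_imp_bounds[OF assms(1) assms(2)[unfolded z]]
  have "\<bar>v $ i\<bar> \<le> R" if "v \<bullet> v \<le> R\<^sup>2" for v :: "real^'a" and i
    using that component_le_norm_cart[of v i] assms(1)
    by (smt (verit) norm_eq_sqrt_inner real_sqrt_le_mono real_sqrt_abs)
  moreover have "x \<bullet> x \<le> R\<^sup>2" "y \<bullet> y \<le> R\<^sup>2"
    using b(2) by (smt (verit) inner_ge_zero)+
  ultimately show ?thesis
    using b by (auto simp: z par_box_def cbox_Pair_eq uminus_prod_def mem_box_cart abs_le_iff minus_le_iff)
qed

lemma bump_not_par_box: "0 < R \<Longrightarrow> z \<notin> par_box R \<Longrightarrow> bump R z = 0"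
  using flat_outside[of R z 0] gauge4_less_imp_par_box[of R z] by (force simp: bump_def)

text \<open>The bump does not vanish for negative t, which is allowed, since test functions live on
  all of R x H_n; for T = \<infinity> the condition t < T is automatic.\<close>

lemma test_fun_bump:
  assumes "0 < R"
  shows "test_fun \<infinity> (bump R :: real \<times> 'n::finite heis \<Rightarrow> real)"
proof -
  have "real_polynomial_function (\<lambda>z::real \<times> 'n heis. 1 - gauge4 z / R ^ 4)"
    by (intro real_polynomial_function_diff real_polynomial_function_divide real_polynomial_function_gauge4) auto
  then have "smooth_fun (bump R :: real \<times> 'n heis \<Rightarrow> real)"
    unfolding bump_eq by (rule smooth_fun_flat)
  moreover have "{z::real \<times> 'n heis. bump R z \<noteq> 0} \<subseteq> par_box R"
    using bump_not_par_box[OF assms] by blast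
  then have "bounded {z::real \<times> 'n heis. bump R z \<noteq> 0}"
    unfolding par_box_def by (rule bounded_subset[OF bounded_cbox])
  ultimately show ?thesis
    by (simp add: test_fun_def compact_closure)
qed

lemma dt_bump_0: "dt (bump R) (0, \<eta>) = 0"
proof -
  obtain x y \<tau> where "\<eta> = (x, y, \<tau>)" by (metis surj_pair)
  then show ?thesis by (simp add: bump_eq dt_flat_gauge4)
qed

section \<open>Size of the adjoint operator on the bump\<close>

lemma abs_damped_op_bump_le:
  fixes x y :: "real^'n" and t \<tau> :: real
  defines "w \<equiv> \<lambda>R m. flat m (1 - gauge4 (t, x, y, \<tau>) / R ^ 4)"
  defines "r \<equiv> x \<bullet> x + y \<bullet> y"
  assumes "0 < R"
  shows "\<bar>damped_op (bump R) (t, x, y, \<tau>)\<bar>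
    \<le> (4 * t\<^sup>2 + r * (16 * r\<^sup>2 + \<tau>\<^sup>2)) / (R ^ 4)\<^sup>2 * (w R 4 + 2 * w R 3)
      + (2 * \<bar>t\<bar> + 2 + (8 * CARD('n) + 17 / 2) * r) / R ^ 4 * w R 2"
proof -
  have r: "0 \<le> r" by (simp add: r_def)
  let ?a = "4 * t\<^sup>2 - r * (16 * r\<^sup>2 + \<tau>\<^sup>2)" and ?b = "2 * t - 2 + (8 * CARD('n) + 17 / 2) * r"
  have "\<bar>damped_op (bump R) (t, x, y, \<tau>)\<bar> \<le> \<bar>?a / (R ^ 4)\<^sup>2 * (w R 4 - 2 * w R 3)\<bar> + \<bar>?b / R ^ 4 * w R 2\<bar>"
    unfolding damped_op_bump w_def r_def by (rule abs_triangle_ineq)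
  also have "\<dots> = \<bar>?a\<bar> / (R ^ 4)\<^sup>2 * \<bar>w R 4 - 2 * w R 3\<bar> + \<bar>?b\<bar> / R ^ 4 * w R 2"
    using assms by (simp add: abs_mult w_def)
  also have "\<dots> \<le> (4 * t\<^sup>2 + r * (16 * r\<^sup>2 + \<tau>\<^sup>2)) / (R ^ 4)\<^sup>2 * (w R 4 + 2 * w R 3)
      + (2 * \<bar>t\<bar> + 2 + (8 * CARD('n) + 17 / 2) * r) / R ^ 4 * w R 2"
  proof (intro add_mono mult_mono divide_right_mono)
    have "0 \<le> r * (16 * r\<^sup>2 + \<tau>\<^sup>2)" using r by simp
    then show "\<bar>?a\<bar> \<le> 4 * t\<^sup>2 + r * (16 * r\<^sup>2 + \<tau>\<^sup>2)"
      by (simp add: abs_le_iff)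
    have "0 \<le> q \<Longrightarrow> \<bar>2 * t - 2 + q\<bar> \<le> 2 * \<bar>t\<bar> + 2 + q" for q
      by linarith
    then show "\<bar>?b\<bar> \<le> 2 * \<bar>t\<bar> + 2 + (8 * CARD('n) + 17 / 2) * r"
      using r by simp
    show "\<bar>w R 4 - 2 * w R 3\<bar> \<le> w R 4 + 2 * w R 3"
      using flat_nonneg by (simp add: w_def abs_le_iff)
  qed (use r in \<open>auto simp: w_def\<close>)
  finally show ?thesis .
qed

text \<open>Where the gauge is below R^4, the quantities |t|, r and |tau| are at most S = R^2. Hence
  the two coefficients in \<open>abs_damped_op_bump_le\<close> are O(1/S), and
  \<open>flat_le_flat0_powr\<close> converts the remaining \<open>flat\<close> factors.\<close>

lemma damped_op_bump_le:
  assumes "1 < p"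
  obtains C where "0 < C" "\<And>R z. 1 \<le> R \<Longrightarrow>
    \<bar>R\<^sup>2 * damped_op (bump R :: real \<times> 'n::finite heis \<Rightarrow> real) z\<bar> \<le> C * bump R z powr (1 / p)"
proof -
  define c where "c m = fact m / (1 - 1 / p) ^ m" for m
  have c: "0 < c m" for m using assms by (simp add: c_def)
  \<comment> \<open>Here 21 = 4 + 16 + 1 counts the cubic terms in S, and 25/2 = 2 + 2 + 17/2
    collects the linear ones.\<close>
  define C where "C = 21 * (c 4 + 2 * c 3) + (8 * CARD('n) + 25 / 2) * c 2"
  have C: "0 < C"
    unfolding C_def using c by (intro add_pos_pos mult_pos_pos) auto
  have "\<bar>R\<^sup>2 * damped_op (bump R :: real \<times> 'n heis \<Rightarrow> real) z\<bar> \<le> C * bump R z powr (1 / p)" if R: "1 \<le> R" for R z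
  proof -
    obtain t x y \<tau> where z: "z = (t, x, y, \<tau>)" by (metis surj_pair)
    define w where "w m = flat m (1 - gauge4 z / R ^ 4)" for m
    define r where "r = x \<bullet> x + y \<bullet> y"
    have r: "0 \<le> r" by (simp add: r_def)
    have le: "\<bar>damped_op (bump R) z\<bar> \<le> (4 * t\<^sup>2 + r * (16 * r\<^sup>2 + \<tau>\<^sup>2)) / (R ^ 4)\<^sup>2 * (w 4 + 2 * w 3)
        + (2 * \<bar>t\<bar> + 2 + (8 * CARD('n) + 17 / 2) * r) / R ^ 4 * w 2"
      unfolding z w_def r_def using R by (intro abs_damped_op_bump_le) simp
    show ?thesis
    proof (cases "gauge4 z < R ^ 4")
      case False
      then have "w m = 0" for m using R flat_outside[of R z m] by (simp add: w_def)
      then have "damped_op (bump R) z = 0" using le R by simp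
      then show ?thesis using C by simp
    next
      case True
      define S where "S = R\<^sup>2"
      have S: "1 \<le> S" "R ^ 4 = S\<^sup>2" using R by (auto simp: S_def)
      have b: "\<bar>t\<bar> \<le> S" "r \<le> S" "\<bar>\<tau>\<bar> \<le> S"
        using gauge4_less_imp_bounds[of R t x y \<tau>] R True by (auto simp: z r_def S_def)
      have sq: "t\<^sup>2 \<le> S\<^sup>2" "r\<^sup>2 \<le> S\<^sup>2" "\<tau>\<^sup>2 \<le> S\<^sup>2"
        using power_mono[OF b(1), of 2] power_mono[OF b(2), of 2] power_mono[OF b(3), of 2] r by simp_all
      \<comment> \<open>The term from the second time derivative is only quadratic in S, one order
        below the others; S \<ge> 1 raises it to a cubic one.\<close>
      have "4 * t\<^sup>2 \<le> 4 * S\<^sup>2 * 1" using sq by simp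
      also have "\<dots> \<le> 4 * S\<^sup>2 * S" using S(1) by (rule mult_left_mono) simp
      finally have "4 * t\<^sup>2 \<le> 4 * S\<^sup>2 * S" .
      moreover have "r * (16 * r\<^sup>2 + \<tau>\<^sup>2) \<le> S * (16 * S\<^sup>2 + S\<^sup>2)"
        using sq b S by (intro mult_mono add_mono) auto
      ultimately have "4 * t\<^sup>2 + r * (16 * r\<^sup>2 + \<tau>\<^sup>2) \<le> 4 * S\<^sup>2 * S + S * (16 * S\<^sup>2 + S\<^sup>2)"
        by (rule add_mono)
      also have "\<dots> = 21 * (S\<^sup>2)\<^sup>2 / S" using S by (simp add: power2_eq_square)
      finally have 1: "S * ((4 * t\<^sup>2 + r * (16 * r\<^sup>2 + \<tau>\<^sup>2)) / (S\<^sup>2)\<^sup>2) \<le> 21"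
        using S by (simp add: field_simps)
      have "2 * \<bar>t\<bar> + 2 + (8 * CARD('n) + 17 / 2) * r \<le> 2 * S + 2 * S + (8 * CARD('n) + 17 / 2) * S"
        using b S by (intro add_mono mult_left_mono) auto
      also have "\<dots> = (8 * CARD('n) + 25 / 2) * S"
        by (simp add: distrib_right)
      finally have "2 * \<bar>t\<bar> + 2 + (8 * CARD('n) + 17 / 2) * r \<le> (8 * CARD('n) + 25 / 2) * S" .
      moreover have "S * (q / S\<^sup>2) \<le> B" if "q \<le> B * S" for q B
        using S that by (simp add: power2_eq_square divide_le_eq)
      ultimately have 2: "S * ((2 * \<bar>t\<bar> + 2 + (8 * CARD('n) + 17 / 2) * r) / S\<^sup>2) \<le> 8 * CARD('n) + 25 / 2"
        by blast
      have "\<bar>R\<^sup>2 * damped_op (bump R) z\<bar> = S * \<bar>damped_op (bump R) z\<bar>"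
        using S by (simp add: S_def abs_mult)
      also have "\<dots> \<le> S * ((4 * t\<^sup>2 + r * (16 * r\<^sup>2 + \<tau>\<^sup>2)) / (S\<^sup>2)\<^sup>2 * (w 4 + 2 * w 3)
          + (2 * \<bar>t\<bar> + 2 + (8 * CARD('n) + 17 / 2) * r) / S\<^sup>2 * w 2)"
        using le S(1) unfolding S(2) by (intro mult_left_mono) auto
      also have "\<dots> = S * ((4 * t\<^sup>2 + r * (16 * r\<^sup>2 + \<tau>\<^sup>2)) / (S\<^sup>2)\<^sup>2) * (w 4 + 2 * w 3)
          + S * ((2 * \<bar>t\<bar> + 2 + (8 * CARD('n) + 17 / 2) * r) / S\<^sup>2) * w 2"
        by (simp only: distrib_left mult.assoc)
      also have "\<dots> \<le> 21 * (w 4 + 2 * w 3) + (8 * CARD('n) + 25 / 2) * w 2"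
        by (intro add_mono mult_right_mono 1 2) (auto simp: w_def)
      also have "\<dots> \<le> 21 * (c 4 * w 0 powr (1 / p) + 2 * (c 3 * w 0 powr (1 / p)))
          + (8 * CARD('n) + 25 / 2) * (c 2 * w 0 powr (1 / p))"
        unfolding w_def c_def by (intro add_mono mult_left_mono flat_le_flat0_powr assms) auto
      also have "\<dots> = C * bump R z powr (1 / p)"
        by (simp add: C_def bump_def w_def algebra_simps)
      finally show ?thesis .
    qed
  qed
  with C show thesis using that by blast
qed

text \<open>At a fixed point the numerators a and b do not depend on R and the \<open>flat\<close>
  factors are bounded, so the product is O(R^(-6)) + O(R^(-2)).\<close>

lemma damped_op_bump_tendsto_0:
  "(\<lambda>k. (real (Suc k))\<^sup>2 * damped_op (bump (real (Suc k))) z) \<longlonglongrightarrow> 0"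
proof -
  obtain t x y \<tau> where z: "z = (t, x, y, \<tau>)" by (metis surj_pair)
  define r where "r = x \<bullet> x + y \<bullet> y"
  have r: "0 \<le> r" by (simp add: r_def)
  define a b where "a = 4 * t\<^sup>2 + r * (16 * r\<^sup>2 + \<tau>\<^sup>2)" and "b = 2 * \<bar>t\<bar> + 2 + (8 * CARD('a) + 17 / 2) * r"
  have ab: "0 \<le> a" "0 \<le> b" using r by (auto simp: a_def b_def)
  have "norm (R\<^sup>2 * damped_op (bump R) z) \<le> R\<^sup>2 * (a / (R ^ 4)\<^sup>2 * (fact 4 + 2 * fact 3) + b / R ^ 4 * fact 2)"
    if "1 \<le> R" for R
  proof -
    have "\<bar>damped_op (bump R) z\<bar> \<le> a / (R ^ 4)\<^sup>2 * (flat 4 (1 - gauge4 z / R ^ 4) + 2 * flat 3 (1 - gauge4 z / R ^ 4))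
        + b / R ^ 4 * flat 2 (1 - gauge4 z / R ^ 4)"
      using abs_damped_op_bump_le[of R t x y \<tau>] that by (simp only: z r_def a_def b_def)
    also have "\<dots> \<le> a / (R ^ 4)\<^sup>2 * (fact 4 + 2 * fact 3) + b / R ^ 4 * fact 2"
      using ab by (intro add_mono mult_left_mono flat_le_const) auto
    finally show ?thesis
      by (simp add: abs_mult mult_left_mono)
  qed
  then have "\<forall>\<^sub>F k in sequentially. norm ((real (Suc k))\<^sup>2 * damped_op (bump (real (Suc k))) z)
      \<le> (real (Suc k))\<^sup>2 * (a / (real (Suc k) ^ 4)\<^sup>2 * (fact 4 + 2 * fact 3) + b / real (Suc k) ^ 4 * fact 2)"
    by (intro always_eventually allI) simp
  moreover have "(\<lambda>k. (real (Suc k))\<^sup>2 * (a / (real (Suc k) ^ 4)\<^sup>2 * (fact 4 + 2 * fact 3) + b / real (Suc k) ^ 4 * fact 2)) \<longlonglongrightarrow> 0"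
    by real_asymp
  ultimately show ?thesis
    by (rule Lim_null_comparison)
qed

subsection \<open>Estimates for a global weak solution\<close>

text \<open>Young's inequality for a/\<epsilon> and \<epsilon> b, with the factors 1/p and 1/q
  bounded by 1.\<close>

lemma young_weighted:
  fixes a b \<epsilon> p q :: real
  assumes "1 < p" "1 < q" "1 / p + 1 / q = 1" "0 \<le> a" "0 \<le> b" "0 < \<epsilon>"
  shows "a * b \<le> \<epsilon> powr (- p) * a powr p + \<epsilon> powr q * b powr q"
proof -
  have "a * b = (a / \<epsilon>) * (\<epsilon> * b)"
    using assms by simp
  also have "\<dots> \<le> (a / \<epsilon>) powr p / p + (\<epsilon> * b) powr q / q"
    using assms by (intro Youngs_inequality) auto
  also have "\<dots> \<le> (a / \<epsilon>) powr p + (\<epsilon> * b) powr q"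
    using assms by (intro add_mono) (auto simp: divide_le_eq_1 mult_le_cancel_left1 divide_le_eq)
  also have "\<dots> = \<epsilon> powr (- p) * a powr p + \<epsilon> powr q * b powr q"
    by (simp add: powr_divide powr_mult powr_minus_divide)
  finally show ?thesis .
qed

lemma damped_op_bump_not_par_box:
  assumes "1 \<le> R" "z \<notin> par_box R"
  shows "damped_op (bump R) z = 0"
proof -
  \<comment> \<open>The exponent 2 is an arbitrary choice: any bound by a positive power of the bump
    makes the operator vanish where the bump does.\<close>
  obtain C where "\<bar>R\<^sup>2 * damped_op (bump R) z\<bar> \<le> C * bump R z powr (1 / 2)"
    using damped_op_bump_le[of 2] assms(1) by (metis one_less_numeral_iff semiring_norm(76))
  then show ?thesis
    using assms bump_not_par_box[of R z] by auto
qed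

lemma strip_infinity: "strip \<infinity> = {z. 0 \<le> fst z}"
  by (simp add: strip_def)

lemma closed_strip_infinity: "closed (strip \<infinity> :: (real \<times> 'n::finite heis) set)"
  unfolding strip_infinity by (intro closed_Collect_le continuous_intros)

lemma compact_par_box: "compact (par_box R)"
  by (simp add: par_box_def compact_cbox)

text \<open>Extending |u|^p by 0 to negative times turns integrals over the strip into integrals
  over the whole space.\<close>

definition dens :: "real \<Rightarrow> (real \<times> 'n::finite heis \<Rightarrow> real) \<Rightarrow> real \<times> 'n heis \<Rightarrow> real" where
  "dens p u z = indicator (strip \<infinity>) z * \<bar>u z\<bar> powr p"

lemma dens_nonneg [simp]: "0 \<le> dens p u z"
  by (simp add: dens_def)

lemma sets_strip_infinity [measurable]: "strip \<infinity> \<in> sets borel"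
  using closed_strip_infinity by (rule borel_closed)

lemma sets_par_box [measurable]: "par_box R \<in> sets borel"
  using compact_par_box by (intro borel_closed compact_imp_closed)

lemma borel_measurable_dens [measurable]:
  assumes "Lp_loc p T u"
  shows "dens p u \<in> borel_measurable borel"
proof -
  have [measurable]: "u \<in> borel_measurable borel"
    using assms by (simp add: Lp_loc_def)
  show ?thesis
    unfolding dens_def[abs_def] by measurable
qed

text \<open>The strip is closed for T = \<infinity>, so it meets the box in a compact set, on which
  |u|^p is integrable by local integrability.\<close>

lemma integrable_dens_mult:
  fixes g :: "real \<times> 'n::finite heis \<Rightarrow> real"
  assumes u: "Lp_loc p \<infinity> u" and [measurable]: "g \<in> borel_measurable borel"
    and "\<And>z. \<bar>g z\<bar> \<le> B" "\<And>z. z \<notin> par_box R \<Longrightarrow> g z = 0"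
  shows "integrable lborel (\<lambda>z. dens p u z * g z)"
proof -
  have "compact (par_box R \<inter> strip \<infinity> :: (real \<times> 'n heis) set)"
    using compact_par_box closed_strip_infinity by (rule compact_Int_closed)
  then have "integrable lborel (\<lambda>z. indicator (par_box R \<inter> strip \<infinity>) z * \<bar>u z\<bar> powr p)"
    using u by (auto simp: Lp_loc_def set_integrable_def)
  then have "integrable lborel (\<lambda>z. B * (indicator (par_box R \<inter> strip \<infinity>) z * \<bar>u z\<bar> powr p))"
    by simp
  moreover have "(\<lambda>z. dens p u z * g z) \<in> borel_measurable lborel"
    using borel_measurable_dens[OF u] by measurable
  moreover have "norm (dens p u z * g z) \<le> norm (B * (indicator (par_box R \<inter> strip \<infinity>) z * \<bar>u z\<bar> powr p))" for z
  proof -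
    have "\<bar>g z\<bar> \<le> \<bar>B\<bar>"
      using assms(3)[of z] by simp
    then have "dens p u z * \<bar>g z\<bar> \<le> dens p u z * \<bar>B\<bar>"
      by (intro mult_left_mono) auto
    then show ?thesis
      using assms(4)[of z] by (cases "z \<in> par_box R") (auto simp: dens_def abs_mult indicator_def mult.commute)
  qed
  ultimately show ?thesis
    by (rule Bochner_Integration.integrable_bound[OF _ _ AE_I2])
qed

text \<open>Raising \<open>damped_op_bump_le\<close> to the power p leaves the bump to the first
  power, so the nonlinear term of the weak formulation can absorb the resulting integral.\<close>

lemma damped_op_bump_bounded:
  assumes "1 < p"
  obtains C where "0 < C" "\<And>R z. 1 \<le> R \<Longrightarrow>
      \<bar>R\<^sup>2 * damped_op (bump R :: real \<times> 'n::finite heis \<Rightarrow> real) z\<bar> powr p \<le> C * bump R z"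
proof -
  obtain C where C: "0 < C" "\<And>R z. 1 \<le> R \<Longrightarrow>
      \<bar>R\<^sup>2 * damped_op (bump R :: real \<times> 'n::finite heis \<Rightarrow> real) z\<bar> \<le> C * bump R z powr (1 / p)"
    using damped_op_bump_le[OF assms] by blast
  have "\<bar>R\<^sup>2 * damped_op (bump R :: real \<times> 'n::finite heis \<Rightarrow> real) z\<bar> powr p \<le> C powr p * bump R z"
    if "1 \<le> R" for R z
  proof -
    have "\<bar>R\<^sup>2 * damped_op (bump R :: real \<times> 'n::finite heis \<Rightarrow> real) z\<bar> powr p \<le> (C * bump R z powr (1 / p)) powr p"
      using C(2)[OF that] assms by (intro powr_mono2) auto
    then show ?thesis
      using assms by (simp add: powr_mult powr_powr)
  qed
  then show thesis
    using that[of "C powr p"] C(1) by simp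
qed

lemma integral_damped_op_bump_le:
  fixes u :: "real \<times> 'n::finite heis \<Rightarrow> real"
  assumes u: "Lp_loc p \<infinity> u" and p: "1 < p" and q: "1 / p + 1 / q = 1" "real CARD('n) + 2 \<le> q"
    and R: "1 \<le> R" and \<epsilon>: "0 < \<epsilon>"
  shows "\<bar>\<integral>z\<in>strip \<infinity>. u z * damped_op (bump R) z \<partial>lborel\<bar>
    \<le> \<epsilon> powr (- p) * (\<integral>z. dens p u z * \<bar>R\<^sup>2 * damped_op (bump R) z\<bar> powr p \<partial>lborel)
      + \<epsilon> powr q * 2 ^ (2 * CARD('n) + 2)"
proof -
  let ?\<psi> = "\<lambda>z::real \<times> 'n heis. \<bar>R\<^sup>2 * damped_op (bump R) z\<bar>"
  let ?b = "1 / R\<^sup>2"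
  let ?f = "\<lambda>z. indicator (strip \<infinity>) z * (u z * damped_op (bump R) z)"
  let ?g = "\<lambda>z. \<epsilon> powr (- p) * (dens p u z * ?\<psi> z powr p) + \<epsilon> powr q * ?b powr q * indicator (par_box R) z"
  have [measurable]: "u \<in> borel_measurable borel"
    using u by (simp add: Lp_loc_def)
  obtain C where C: "0 < C" "\<And>z. ?\<psi> z powr p \<le> C * bump R z"
    using damped_op_bump_bounded[OF p, where 'n = 'n] R by metis
  have C1: "?\<psi> z powr p \<le> C" for z
    using order_trans[OF C(2)[of z] mult_left_mono[OF bump_le_1[of R z], of C]] C(1) by simp
  have int: "integrable lborel (\<lambda>z. dens p u z * ?\<psi> z powr p)"
    using C1 R by (intro integrable_dens_mult[OF u, where B = C and R = R]) (auto simp: damped_op_bump_not_par_box)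
  have fin: "emeasure lborel (par_box R :: (real \<times> 'n heis) set) < \<infinity>"
    using compact_par_box emeasure_bounded_finite compact_imp_bounded by auto
  then have int2: "integrable lborel (indicator (par_box R) :: real \<times> 'n heis \<Rightarrow> real)"
    by simp
  have intg: "integrable lborel ?g"
    by (intro Bochner_Integration.integrable_add integrable_mult_right int int2)
  have le: "norm (?f z) \<le> ?g z" for z
  proof (cases "z \<in> strip \<infinity> \<and> z \<in> par_box R")
    case True
    have "norm (?f z) = (\<bar>u z\<bar> * ?\<psi> z) * ?b"
      using True R by (simp add: abs_mult)
    \<comment> \<open>Young's inequality is applied with b = 1/R^2, the factor removed from the
      operator; its q-th power is then integrated over the box.\<close>
    also have "\<dots> \<le> \<epsilon> powr (- p) * (\<bar>u z\<bar> * ?\<psi> z) powr p + \<epsilon> powr q * ?b powr q"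
      using p q \<epsilon> R by (intro young_weighted) auto
    also have "\<dots> = ?g z"
      using True by (simp add: dens_def powr_mult)
    finally show ?thesis .
  next
    case False
    then have "?f z = 0"
      using R damped_op_bump_not_par_box[of R z] by auto
    moreover have "0 \<le> ?g z"
      by simp
    ultimately show ?thesis
      by (simp only: norm_zero)
  qed
  have intf: "integrable lborel ?f"
    by (rule Bochner_Integration.integrable_bound[OF intg]) (use le in \<open>auto intro: order_trans\<close>)
  have "\<bar>\<integral>z\<in>strip \<infinity>. u z * damped_op (bump R) z \<partial>lborel\<bar> = \<bar>integral\<^sup>L lborel ?f\<bar>"
    by (simp add: set_lebesgue_integral_def)
  also have "\<dots> \<le> integral\<^sup>L lborel ?g"
    using intf intg le by (intro integral_abs_bound_integral) auto
  also have "\<dots> = \<epsilon> powr (- p) * (\<integral>z. dens p u z * ?\<psi> z powr p \<partial>lborel)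
      + \<epsilon> powr q * (?b powr q * measure lborel (par_box R :: (real \<times> 'n heis) set))"
    using int int2 fin by (simp add: Bochner_Integration.integral_add)
  \<comment> \<open>Here the critical exponent enters: q \<ge> n + 2 makes the total power -2 q + 2
    n + 4 of R nonpositive.\<close>
  also have "?b powr q * measure lborel (par_box R :: (real \<times> 'n heis) set) \<le> 2 ^ (2 * CARD('n) + 2)"
  proof -
    have "?b powr q = R powr (- 2 * q)"
      using R by (simp add: powr_divide powr_minus_divide powr_powr flip: powr_numeral)
    moreover have "R ^ (2 * CARD('n) + 4) = R powr (2 * real CARD('n) + 4)"
      using R by (simp flip: powr_realpow)
    moreover have "R powr (- 2 * q) * R powr (2 * real CARD('n) + 4) \<le> 1"
      using R q(2) powr_mono[of "- 2 * q + (2 * real CARD('n) + 4)" 0 R] by (simp flip: powr_add)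
    ultimately have "?b powr q * R ^ (2 * CARD('n) + 4) \<le> 1"
      by simp
    then have "2 ^ (2 * CARD('n) + 2) * (?b powr q * R ^ (2 * CARD('n) + 4)) \<le> 2 ^ (2 * CARD('n) + 2) * 1"
      by (intro mult_left_mono) auto
    then show ?thesis
      using R by (simp add: measure_par_box mult.left_commute)
  qed
  finally show ?thesis
    by (simp add: mult_left_mono)
qed

lemma weak_solution_bump:
  fixes u :: "real \<times> 'n::finite heis \<Rightarrow> real"
  assumes "weak_solution p u0 u1 \<infinity> u" "0 < R"
  shows "(\<integral>z. dens p u z * bump R z \<partial>lborel) + (\<integral>\<eta>. (u0 \<eta> + u1 \<eta>) * bump R (0, \<eta>) \<partial>lborel)
    = (\<integral>z\<in>strip \<infinity>. u z * damped_op (bump R) z \<partial>lborel)"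
proof -
  have "(\<integral>z\<in>strip \<infinity>. \<bar>u z\<bar> powr p * bump R z \<partial>lborel) = (\<integral>z. dens p u z * bump R z \<partial>lborel)"
    by (simp add: set_lebesgue_integral_def dens_def mult.assoc)
  then show ?thesis
    using assms(1)[unfolded weak_solution_def, THEN conjunct2, rule_format, OF test_fun_bump[OF assms(2)]]
    by (simp add: dt_bump_0 damped_op_def)
qed

section \<open>Convergence of the data integrals over D_R\<close>

lemma integral_DR_tendsto:
  fixes f :: "'n::finite heis \<Rightarrow> real"
  assumes "integrable lborel f"
  shows "((\<lambda>R. \<integral>\<eta>\<in>DR R. f \<eta> \<partial>lborel) \<longlongrightarrow> (\<integral>\<eta>. f \<eta> \<partial>lborel)) at_top"
proof -
  have [measurable]: "f \<in> borel_measurable borel"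
    using assms by (simp add: borel_measurable_integrable)
  have "DR R = {\<eta>::'n heis. norm (fst \<eta>) < R} \<inter> {\<eta>. norm (fst (snd \<eta>)) < R} \<inter> {\<eta>. \<bar>snd (snd \<eta>)\<bar> \<le> R\<^sup>2}" for R
    by (auto simp: DR_def)
  moreover have "open {\<eta>::'n heis. norm (fst \<eta>) < R}" "open {\<eta>::'n heis. norm (fst (snd \<eta>)) < R}"
      "closed {\<eta>::'n heis. \<bar>snd (snd \<eta>)\<bar> \<le> R\<^sup>2}" for R
    by (intro open_Collect_less closed_Collect_le continuous_intros)+
  ultimately have [measurable]: "(DR R :: 'n heis set) \<in> sets borel" for R
    by auto
  have lim: "((\<lambda>R. indicator (DR R) \<eta> *\<^sub>R f \<eta>) \<longlongrightarrow> f \<eta>) at_top" for \<eta>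
  proof (rule tendsto_eventually)
    obtain x y \<tau> where \<eta>: "\<eta> = (x, y, \<tau>)" by (metis surj_pair)
    have "\<forall>\<^sub>F R in at_top. norm x < R \<and> norm y < R \<and> \<bar>\<tau>\<bar> < R \<and> 1 < R"
      by (intro eventually_conj eventually_gt_at_top)
    then show "\<forall>\<^sub>F R in at_top. indicator (DR R) \<eta> *\<^sub>R f \<eta> = f \<eta>"
    proof eventually_elim
      case (elim R)
      \<comment> \<open>R > 1 gives |tau| < R \<le> R^2, so every point eventually lies in
        \<open>DR R\<close>.\<close>
      have "R * 1 \<le> R * R" using elim by (intro mult_left_mono) auto
      then have "\<bar>\<tau>\<bar> \<le> R\<^sup>2" using elim unfolding power2_eq_square by linarith
      then have "\<eta> \<in> DR R" using elim by (simp add: \<eta> DR_def)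
      then show ?case by simp
    qed
  qed
  show ?thesis
    unfolding set_lebesgue_integral_def
    by (rule integral_dominated_convergence_at_top[where w = "\<lambda>\<eta>. norm (f \<eta>)"])
      (use assms lim in \<open>auto simp: indicator_def\<close>)
qed

section \<open>Absorption, passage to the limit and contradiction\<close>

lemma no_global_weak_solution:
  fixes u :: "real \<times> 'n::finite heis \<Rightarrow> real"
  assumes "integrable lborel u0" "integrable lborel u1" and pos: "0 < (\<integral>\<eta>. u0 \<eta> + u1 \<eta> \<partial>lborel)"
    and weak: "weak_solution p u0 u1 \<infinity> u" and p: "1 < p" "p \<le> 1 + 2 / (2 * real CARD('n) + 2)"
  shows False
proof -
  define q where "q = p / (p - 1)"
  define V :: real where "V = 2 ^ (2 * CARD('n) + 2)"
  have V: "0 < V" by (simp add: V_def)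
  have q: "1 / p + 1 / q = 1"
    using p by (simp add: q_def divide_simps)
  \<comment> \<open>The bound on p is p - 1 \<le> 1/(n + 1), which is equivalent to q = p/(p - 1)
    \<ge> n + 2.\<close>
  have "(p - 1) * (real CARD('n) + 1) \<le> 1"
    using p(2) by (simp add: field_simps)
  then have "(real CARD('n) + 2) * (p - 1) \<le> p"
    by (simp add: algebra_simps)
  then have q2: "real CARD('n) + 2 \<le> q"
    using p(1) by (simp add: q_def le_divide_eq)
  have u: "Lp_loc p \<infinity> u"
    using weak by (simp add: weak_solution_def)
  note [measurable] = borel_measurable_dens[OF u]
  define R where "R k = real (Suc k)" for k
  have R: "1 \<le> R k" for k by (simp add: R_def)
  define E where "E k = (\<integral>z. dens p u z * bump (R k) z \<partial>lborel)" for k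
  define J where "J k = (\<integral>\<eta>. (u0 \<eta> + u1 \<eta>) * bump (R k) (0, \<eta>) \<partial>lborel)" for k
  define G where "G k = (\<integral>z. dens p u z * \<bar>(R k)\<^sup>2 * damped_op (bump (R k)) z\<bar> powr p \<partial>lborel)" for k
  \<comment> \<open>The parameter \<epsilon> stays free because it is chosen twice: fixed to bound
    E, then small to reach the contradiction.\<close>
  have EJ: "E k + J k \<le> \<epsilon> powr (- p) * G k + \<epsilon> powr q * V" if "0 < \<epsilon>" for \<epsilon> k
    using integral_damped_op_bump_le[OF u p(1) q q2 R that, of k] weak_solution_bump[OF weak, of "R k"] R[of k]
    unfolding E_def J_def G_def V_def by linarith
  obtain C where C: "0 < C" "\<And>R z. 1 \<le> R \<Longrightarrow>
      \<bar>R\<^sup>2 * damped_op (bump R :: real \<times> 'n heis \<Rightarrow> real) z\<bar> powr p \<le> C * bump R z"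
    using damped_op_bump_bounded[OF p(1)] by blast
  have C1: "\<bar>(R k)\<^sup>2 * damped_op (bump (R k) :: real \<times> 'n heis \<Rightarrow> real) z\<bar> powr p \<le> C" for k z
    using order_trans[OF C(2)[OF R, of k z] mult_left_mono[OF bump_le_1[of "R k" z], of C]] C(1) by simp
  have intE: "integrable lborel (\<lambda>z. dens p u z * bump (R k) z)" for k
    using bump_le_1 R[of k] by (intro integrable_dens_mult[OF u, where B = 1 and R = "R k"]) (auto simp: bump_not_par_box)
  have intG: "integrable lborel (\<lambda>z. dens p u z * \<bar>(R k)\<^sup>2 * damped_op (bump (R k)) z\<bar> powr p)" for k
    using C1 R[of k] by (intro integrable_dens_mult[OF u, where B = C and R = "R k"]) (auto simp: damped_op_bump_not_par_box)

  have int01: "integrable lborel (\<lambda>\<eta>. u0 \<eta> + u1 \<eta>)"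
    using assms(1,2) by simp
  then have [measurable]: "(\<lambda>\<eta>. u0 \<eta> + u1 \<eta>) \<in> borel_measurable borel"
    using borel_measurable_integrable by fastforce
  have [measurable]: "(\<lambda>\<eta>::'n heis. bump R (0, \<eta>)) \<in> borel_measurable borel" for R
    by (rule measurable_compose[OF _ borel_measurable_bump])
      (intro borel_measurable_continuous_onI continuous_intros)
  have J_bound: "norm ((u0 \<eta> + u1 \<eta>) * bump (R k) (0, \<eta>)) \<le> norm (u0 \<eta> + u1 \<eta>)" for \<eta> k
    using bump_le_1[of "R k" "(0, \<eta>)"] by (simp add: abs_mult mult_left_le)
  have bump_lim: "(\<lambda>k. bump (R k) z) \<longlonglongrightarrow> exp (- 1)" for z :: "real \<times> 'n heis"
    using bump_tendsto[of z] by (simp add: R_def)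
  have J_lim: "J \<longlonglongrightarrow> (\<integral>\<eta>. (u0 \<eta> + u1 \<eta>) * exp (- 1) \<partial>lborel)"
    unfolding J_def
    by (rule integral_dominated_convergence[where w = "\<lambda>\<eta>. norm (u0 \<eta> + u1 \<eta>)"])
      (use int01 J_bound in \<open>auto intro!: tendsto_mult_left bump_lim\<close>)
  then obtain A where A: "\<And>k. \<bar>J k\<bar> \<le> A"
    using convergent_imp_Bseq[of J] by (auto simp: convergent_def Bseq_def)

  \<comment> \<open>This value makes \<epsilon>^(-p) C = 1/2, so G \<le> C E lets half of E be
    absorbed on the left, bounding E uniformly in k.\<close>
  define \<epsilon> where "\<epsilon> = (2 * C) powr (1 / p)"
  have \<epsilon>: "0 < \<epsilon>" "\<epsilon> powr (- p) * C = 1 / 2"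
    using C(1) p(1) by (simp_all add: \<epsilon>_def powr_powr powr_minus_divide)
  have GE: "G k \<le> C * E k" for k
  proof -
    have "G k \<le> (\<integral>z. C * (dens p u z * bump (R k) z) \<partial>lborel)"
      unfolding G_def
    proof (rule integral_mono[OF intG integrable_mult_right[OF intE]])
      show "dens p u z * \<bar>(R k)\<^sup>2 * damped_op (bump (R k)) z\<bar> powr p \<le> C * (dens p u z * bump (R k) z)" for z
        using mult_left_mono[OF C(2)[OF R] dens_nonneg] by (simp add: mult.left_commute)
    qed
    then show ?thesis by (simp add: E_def)
  qed
  have E_le: "E k \<le> 2 * (A + \<epsilon> powr q * V)" for k
  proof -
    have "\<epsilon> powr (- p) * G k \<le> \<epsilon> powr (- p) * (C * E k)"
      by (intro mult_left_mono GE) auto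
    also have "\<dots> = E k / 2"
      using \<epsilon>(2) by (simp add: mult.assoc[symmetric])
    finally have "\<epsilon> powr (- p) * G k \<le> E k / 2" .
    moreover have "e + j \<le> g + d \<Longrightarrow> g \<le> e / 2 \<Longrightarrow> \<bar>j\<bar> \<le> a \<Longrightarrow> e \<le> 2 * (a + d)" for e j g d a :: real
      by argo
    ultimately show ?thesis
      using EJ[OF \<epsilon>(1), of k] A[of k] by blast
  qed
  have mono: "mono (\<lambda>k. dens p u z * bump (R k) z)" for z
    by (auto intro!: monoI mult_left_mono bump_mono simp: R_def)
  have "mono E"
    unfolding E_def using intE mono by (intro monoI integral_mono) (auto simp: mono_def)
  then obtain L where "E \<longlonglongrightarrow> L"
    using incseq_convergent[of E] E_le by metis
  \<comment> \<open>Monotone convergence: the bumps increase to the constant exp(-1), and E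
    converges because it is monotone and bounded.\<close>
  then have "integrable lborel (\<lambda>z. dens p u z * exp (- 1))"
    unfolding E_def
    by (intro integrable_monotone_convergence[OF intE _ _ _ _, where x = L])
      (auto intro!: mono tendsto_mult_left bump_lim)
  then have intU: "integrable lborel (dens p u)"
    by simp

  have "G \<longlonglongrightarrow> (\<integral>z. 0 \<partial>(lborel :: (real \<times> 'n heis) measure))"
    unfolding G_def
  proof (rule integral_dominated_convergence[where w = "\<lambda>z. dens p u z * C"])
    show "AE z in lborel. (\<lambda>k. dens p u z * \<bar>(R k)\<^sup>2 * damped_op (bump (R k)) z\<bar> powr p) \<longlonglongrightarrow> 0"
    proof (rule AE_I2)
      fix z :: "real \<times> 'n heis"
      have "(\<lambda>k. \<bar>(R k)\<^sup>2 * damped_op (bump (R k)) z\<bar> powr p) \<longlonglongrightarrow> \<bar>0\<bar> powr p"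
        using damped_op_bump_tendsto_0[of z] p(1) by (intro tendsto_powr' tendsto_intros) (auto simp: R_def)
      then show "(\<lambda>k. dens p u z * \<bar>(R k)\<^sup>2 * damped_op (bump (R k)) z\<bar> powr p) \<longlonglongrightarrow> 0"
        by (intro tendsto_mult_right_zero) simp
    qed
  qed (use intU C1 in \<open>auto intro!: mult_left_mono\<close>)
  then have G_lim: "G \<longlonglongrightarrow> 0" by simp

  define c where "c = (\<integral>\<eta>. (u0 \<eta> + u1 \<eta>) * exp (- 1) \<partial>lborel)"
  have c: "0 < c"
    unfolding c_def using pos by simp
  \<comment> \<open>For fixed \<epsilon>, drop E \<ge> 0 and let k tend to infinity, where the term
    with G vanishes.\<close>
  have c_le: "c \<le> \<epsilon> powr q * V" if "0 < \<epsilon>" for \<epsilon>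
  proof (rule LIMSEQ_le)
    show "J \<longlonglongrightarrow> c" using J_lim by (simp add: c_def)
    show "(\<lambda>k. \<epsilon> powr (- p) * G k + \<epsilon> powr q * V) \<longlonglongrightarrow> \<epsilon> powr q * V"
      by (rule tendsto_eq_rhs[OF tendsto_add[OF tendsto_mult_left[OF G_lim] tendsto_const]]) simp
    have "0 \<le> E k" for k
      unfolding E_def by (intro integral_nonneg_AE) auto
    then have "J k \<le> \<epsilon> powr (- p) * G k + \<epsilon> powr q * V" for k
      using EJ[OF that, of k] order_trans[of "J k" "E k + J k"] by (meson le_add_same_cancel2)
    then show "\<exists>N. \<forall>k\<ge>N. J k \<le> \<epsilon> powr (- p) * G k + \<epsilon> powr q * V"
      by blast
  qed
  \<comment> \<open>With this value \<delta>^q V = c/2, so \<open>c_le\<close> would give c \<le>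
    c/2 although c > 0.\<close>
  define \<delta> where "\<delta> = (c / (2 * V)) powr (1 / q)"
  have "0 < \<delta>" "\<delta> powr q = c / (2 * V)"
    using c V q2 by (simp_all add: \<delta>_def powr_powr)
  then show False
    using c_le[of \<delta>] c V by simp
qed

theorem theorem3:
  fixes u0 u1 :: "'n::finite heis \<Rightarrow> real"
    and u :: "real \<times> 'n heis \<Rightarrow> real"
    and p :: real and T :: ereal
  assumes "integrable lborel u0" and "integrable lborel u1"
    and "Liminf at_top (\<lambda>R. ereal (\<integral>\<eta>\<in>DR R. (u0 \<eta> + u1 \<eta>) \<partial>lborel)) > 0"
    and "weak_solution p u0 u1 T u"
    and "lifespan p u0 u1 = T" and "T > 0"
    and "1 < p" and "p \<le> 1 + 2 / (2 * real CARD('n) + 2)"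
  shows "T < \<infinity>"
proof (rule ccontr)
  assume "\<not> T < \<infinity>"
  then have "weak_solution p u0 u1 \<infinity> u"
    using assms(4) by simp
  moreover have "((\<lambda>R. ereal (\<integral>\<eta>\<in>DR R. (u0 \<eta> + u1 \<eta>) \<partial>lborel)) \<longlongrightarrow> ereal (\<integral>\<eta>. u0 \<eta> + u1 \<eta> \<partial>lborel)) at_top"
    using assms(1,2) by (intro tendsto_ereal integral_DR_tendsto) simp
  \<comment> \<open>Integrability of the data makes the lower limit a true limit, so the hypothesis
    says that the full integral of u0 + u1 is positive.\<close>
  then have "Liminf at_top (\<lambda>R. ereal (\<integral>\<eta>\<in>DR R. (u0 \<eta> + u1 \<eta>) \<partial>lborel)) = ereal (\<integral>\<eta>. u0 \<eta> + u1 \<eta> \<partial>lborel)"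
    by (intro lim_imp_Liminf trivial_limit_at_top_linorder)
  then have "0 < (\<integral>\<eta>. u0 \<eta> + u1 \<eta> \<partial>lborel)"
    using assms(3) by simp
  ultimately show False
    using no_global_weak_solution assms(1,2,7,8) by blast
qed

end
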